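(* Let $\mu>0$ be a constant. On $\mathbb{R}^3$ define $\mathbf{u}_{\mathrm{st}}(\mathbf{x})=\frac{2\mu}{|\mathbf{x}|^2}\mathbf{x}$ for $\mathbf{x}\neq\mathbf{0}$ and $\mathbf{u}_{\mathrm{st}}(\mathbf{0})=\mathbf{0}$; this is a stationary solution of $\mathbf{u}_t+(\mathbf{u}\cdot\nabla)\mathbf{u}=\mu\Delta\mathbf{u}$ on $\mathbb{R}^3\smallsetminus\{\mathbf{0}\}$. Define further $$u_{\mathrm{nst}}(t,r)=2\mu\left(\frac1r-\frac{\exp\left(-\frac{r^2}{4\mu t}\right)}{\sqrt{\mu\pi t}\,\operatorname{erf}\left(\frac{r}{\sqrt{4\mu t}}\right)}\right)\qquad (t,r>0),$$ and $\mathbf{u}_{\mathrm{nst}}:(0,\infty)\times\mathbb{R}^3\to\mathbb{R}^3$ by $\mathbf{u}_{\mathrm{nst}}(t,\mathbf{x})=u_{\mathrm{nst}}(t,|\mathbf{x}|)\frac{\mathbf{x}}{|\mathbf{x}|}$ for $t>0$, $\mathbf{x}\neq\mathbf{0}$, and $\mathbf{u}_{\mathrm{nst}}(t,\mathbf{0})=\mathbf{0}$ for $t>0$. Then, for every $p$ with $1\leq p<3$, the (non-stationary) function $\mathbf{u}_{\mathrm{nst}}$ is an $L^p$-acceptable solution to the Cauchy problem for $\mathbf{u}_t+(\mathbf{u}\cdot\nabla)\mathbf{u}=\mu\Delta\mathbf{u}$ in dimension $n=3$ with initial data $\mathbf{u}_{\mathrm{st}}$. In particular, the Cauchy problem with initial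 data $\mathbf{u}_{\mathrm{st}}$ has, in the sense of $L^p(\mathbb{R}^3)$ with $1\leq p<3$, the two distinct solutions $\mathbf{u}_{\mathrm{st}}$ (singular at $\mathbf{x}=\mathbf{0}$) and $\mathbf{u}_{\mathrm{nst}}$.
   Context: For $\mathbf{u}=(u_1,\dots,u_n)^T$ depending on $(t,\mathbf{x})$ with $t>0$, $\mathbf{x}\in\mathbb{R}^n$, one sets $(\mathbf{u}\cdot\nabla)\mathbf{u}:=(D_{\mathbf{x}}\mathbf{u})\,\mathbf{u}$, where $D_{\mathbf{x}}\mathbf{u}$ is the Jacobian matrix of $\mathbf{u}$ with respect to $\mathbf{x}$; $\Delta$ is the Laplacian in $\mathbf{x}$, acting component-wise. The error function is $\operatorname{erf}(z)=\frac{2}{\sqrt\pi}\int_0^ze^{-s^2}\,ds$. Definition ($L^p$-acceptable solution). Given a measurable function $\mathbf{u}_0:\mathbb{R}^n\to\mathbb{R}^n$ and $p\geq1$, a function $\mathbf{u}:(0,\infty)\times\mathbb{R}^n\to\mathbb{R}^n$ is an $L^p$-acceptable solution to the Cauchy problem with initial data $\mathbf{u}_0$ provided: (i) $\mathbf{u}_t$, $D_{\mathbf{x}}\mathbf{u}$, $\Delta\mathbf{u}$ exist and are continuous on $(0,\infty)\times\mathbb{R}^n$; (ii) $\mathbf{u}$ satisfies $\mathbf{u}_t+(\mathbf{u}\cdot\nabla)\mathbf{u}=\mu\Delta\mathbf{u}$ classically at all points of $(0,\infty)\times\mathbb{R}^n$; (iii) $\mathbf{u}(t)\to\mathbf{u}_0$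 in $L^p(\mathbb{R}^n)$ as $t\to0+$, i.e. $\|\mathbf{u}(t)-\mathbf{u}_0\|_{L^p(\mathbb{R}^n)}\to0$. (No condition other than measurability is imposed on $\mathbf{u}_0$; in particular $\mathbf{u}_0$ may be unbounded and need not belong to $L^p(\mathbb{R}^n)$.) *)

theory Defs
  imports "HOL-Analysis.Analysis"
begin

definition erf :: "real \<Rightarrow> real" where
  "erf z = 2 / sqrt pi * (LBINT s=0..ereal z. exp (- (s\<^sup>2)))"

definition partially_differentiable :: "'n::finite \<Rightarrow> (real^'n \<Rightarrow> real) \<Rightarrow> real^'n \<Rightarrow> bool" where
  "partially_differentiable j f x \<longleftrightarrow>
     (\<lambda>h. f (x + h *\<^sub>R axis j 1)) field_differentiable (at 0)"

definition partial_deriv :: "'n::finite \<Rightarrow> (real^'n \<Rightarrow> real) \<Rightarrow> real^'n \<Rightarrow> real" where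
  "partial_deriv j f x = deriv (\<lambda>h. f (x + h *\<^sub>R axis j 1)) 0"

definition laplacian_exists :: "(real^'n \<Rightarrow> real) \<Rightarrow> real^'n::finite \<Rightarrow> bool" where
  "laplacian_exists f x \<longleftrightarrow>
     (\<forall>j. (\<forall>\<^sub>F y in nhds x. partially_differentiable j f y) \<and>
          partially_differentiable j (partial_deriv j f) x)"

definition laplacian :: "(real^'n \<Rightarrow> real) \<Rightarrow> real^'n::finite \<Rightarrow> real" where
  "laplacian f x = (\<Sum>j\<in>UNIV. partial_deriv j (partial_deriv j f) x)"

definition vec_laplacian :: "(real^'n \<Rightarrow> real^'n) \<Rightarrow> real^'n::finite \<Rightarrow> real^'n" where
  "vec_laplacian v x = (\<chi> i. laplacian (\<lambda>y. v y $ i) x)"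

(* \<Omega> is meant to be open. Existence of the Jacobian is expressed as total differentiability; since
   the Jacobian is also required to be continuous, this agrees with existence of all first-order
   partial derivatives. Only the values of u at positive times matter. *)
definition classical_solution_on ::
    "real \<Rightarrow> (real^'n) set \<Rightarrow> (real \<Rightarrow> real^'n \<Rightarrow> real^'n::finite) \<Rightarrow> bool" where
  "classical_solution_on \<mu> \<Omega> u \<longleftrightarrow>
     (\<forall>t>0. \<forall>x\<in>\<Omega>. (\<lambda>s. u s x) differentiable (at t) \<and>
                    u t differentiable (at x) \<and>
                    (\<forall>i. laplacian_exists (\<lambda>y. u t y $ i) x)) \<and>
     continuous_on ({0<..} \<times> \<Omega>) (\<lambda>(t, x). vector_derivative (\<lambda>s. u s x) (at t)) \<and>
     continuous_on ({0<..} \<times> \<Omega>) (\<lambda>(t, x). jacobian (u t) (at x)) \<and>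
     continuous_on ({0<..} \<times> \<Omega>) (\<lambda>(t, x). vec_laplacian (u t) x) \<and>
     (\<forall>t>0. \<forall>x\<in>\<Omega>. vector_derivative (\<lambda>s. u s x) (at t) + jacobian (u t) (at x) *v u t x
                    = \<mu> *\<^sub>R vec_laplacian (u t) x)"

(* The L^p norm with values in [0, \<infinity>]; the case distinction is needed because powr is not available
   on ennreal. *)
definition Lp_norm :: "real \<Rightarrow> (real^'n \<Rightarrow> real^'n::finite) \<Rightarrow> ennreal" where
  "Lp_norm p f =
     (let I = (\<integral>\<^sup>+ x. ennreal (norm (f x) powr p) \<partial>lebesgue)
      in if I = \<infinity> then \<infinity> else ennreal (enn2real I powr (1 / p)))"

definition tends_in_Lp ::
    "real \<Rightarrow> (real \<Rightarrow> real^'n \<Rightarrow> real^'n) \<Rightarrow> (real^'n \<Rightarrow> real^'n::finite) \<Rightarrow> bool" where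
  "tends_in_Lp p u u\<^sub>0 \<longleftrightarrow>
     ((\<lambda>t. Lp_norm p (\<lambda>x. u t x - u\<^sub>0 x)) \<longlongrightarrow> 0) (at_right 0)"

definition Lp_acceptable_solution ::
    "real \<Rightarrow> real \<Rightarrow> (real^'n \<Rightarrow> real^'n) \<Rightarrow> (real \<Rightarrow> real^'n \<Rightarrow> real^'n::finite) \<Rightarrow> bool" where
  "Lp_acceptable_solution \<mu> p u\<^sub>0 u \<longleftrightarrow>
     u\<^sub>0 \<in> borel_measurable lebesgue \<and> 1 \<le> p \<and>
     classical_solution_on \<mu> UNIV u \<and> tends_in_Lp p u u\<^sub>0"

definition u_st :: "real \<Rightarrow> real^3 \<Rightarrow> real^3" where
  "u_st \<mu> x = (if x = 0 then 0 else (2 * \<mu> / (norm x)\<^sup>2) *\<^sub>R x)"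

definition u_nst_radial :: "real \<Rightarrow> real \<Rightarrow> real \<Rightarrow> real" where
  "u_nst_radial \<mu> t r =
     2 * \<mu> * (1 / r - exp (- (r\<^sup>2 / (4 * \<mu> * t)))
                      / (sqrt (\<mu> * pi * t) * erf (r / sqrt (4 * \<mu> * t))))"

definition u_nst :: "real \<Rightarrow> real \<Rightarrow> real^3 \<Rightarrow> real^3" where
  "u_nst \<mu> t x = (if x = 0 then 0 else u_nst_radial \<mu> t (norm x) *\<^sub>R (x /\<^sub>R norm x))"

end

theory Submission
  imports Defs
begin

text \<open>
  If \<open>\<phi>\<close> is a positive solution of the heat equation \<open>\<phi>\<^sub>t = \<mu> \<Delta>\<phi>\<close>, then the Cole-Hopf transform
  \<open>u = - 2 \<mu> \<nabla>\<phi> / \<phi>\<close> solves \<open>u\<^sub>t + (u \<bullet> \<nabla>) u = \<mu> \<Delta>u\<close>. In three dimensions \<open>\<phi> = 1 / r\<close> is harmonic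
  off the origin and produces the stationary field. Its Newtonian singularity is smoothed instantly
  by the heat flow: \<open>\<phi> = erf (r / sqrt (4 \<mu> t)) / r\<close> solves the heat equation on the whole space,
  has the same initial values, and produces the non-stationary field.

  The verification is done directly on the velocities. The function \<open>erf s / s\<close> is a constant times
  an entire function of \<open>s\<^sup>2\<close>, the zeroth Gaussian moment \<open>m\<close> over the unit interval, and \<open>m\<close> is positive on
  the real line. With \<open>z = |x|\<^sup>2 / (4 \<mu> t)\<close> the non-stationary field becomes \<open>- (m'(z) / m(z)) x / t\<close>
  (\<open>u_nst_eq\<close>), which is smooth through the origin. For a radial field \<open>h (x \<bullet> x) x\<close> the equation is a
  scalar one (\<open>radial_classical_solution\<close>). For the stationary field it is a rational identity. For
  the other field it is an ordinary differential equation for \<open>m' / m\<close> (\<open>log_slope_ode\<close>), which follows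
  from the recurrence satisfied by the moments.

  The difference of the two fields has modulus \<open>(2 \<mu> / r) exp (- z) / m(z)\<close>. This is self-similar, so
  that its \<open>L\<^sup>p\<close> norm is a constant times \<open>t powr ((3 - p) / (2 p))\<close> (\<open>Lp_norm_u_nst_minus_u_st\<close>), which tends
  to \<open>0\<close> for \<open>p < 3\<close>. The constant is finite because \<open>r powr - p\<close> is integrable at the origin of
  three-dimensional space and the factor \<open>exp (- z) / m(z)\<close> decays exponentially; it is
  nonzero because the two fields differ everywhere except at the origin. The same two facts show that the
  second field does depend on time.
\<close>

section \<open>Gaussian moments on the unit interval\<close>

text \<open>
  After the substitution \<open>s = z y\<close>, the integral \<open>\<integral>\<^sub>0\<^sup>z exp (- s\<^sup>2) ds\<close> equals \<open>z\<close> times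
  the zeroth of these moments at \<open>z\<^sup>2\<close>. Parametrising by the square makes every moment an entire
  function, and differentiation only raises the index.
\<close>

definition gauss_moment :: "nat \<Rightarrow> real \<Rightarrow> real" where
  "gauss_moment k z = integral {0..1} (\<lambda>y. y ^ (2 * k) * exp (- (z * y\<^sup>2)))"

lemma gauss_moment_has_real_derivative: "(gauss_moment k has_real_derivative - gauss_moment (Suc k) z) (at z)"
proof -
  have "((\<lambda>z. integral (cbox 0 1) (\<lambda>y. y ^ (2 * k) * exp (- (z * y\<^sup>2)))) has_real_derivative
         integral (cbox 0 1) (\<lambda>y. - (y ^ (2 * Suc k) * exp (- (z * y\<^sup>2))))) (at z within UNIV)"
  proof (rule leibniz_rule_field_derivative)
    show "((\<lambda>z. y ^ (2 * k) * exp (- (z * y\<^sup>2))) has_real_derivative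
           - (y ^ (2 * Suc k) * exp (- (z * y\<^sup>2)))) (at z within UNIV)" for y z :: real
      by (auto intro!: derivative_eq_intros simp: power2_eq_square)
    show "continuous_on (UNIV \<times> cbox 0 1) (\<lambda>(z, y). - (y ^ (2 * Suc k) * exp (- (z * y\<^sup>2 :: real))))"
      by (auto simp: case_prod_beta intro!: continuous_intros)
  qed (auto intro!: integrable_continuous_real continuous_intros)
  then show ?thesis
    by (simp add: gauss_moment_def[abs_def] cbox_interval)
qed

lemma gauss_moment_chain [derivative_intros]:
  assumes "(f has_real_derivative f') (at x within A)" "D = - gauss_moment (Suc k) (f x) * f'"
  shows "((\<lambda>x. gauss_moment k (f x)) has_real_derivative D) (at x within A)"
  using DERIV_chain2[OF gauss_moment_has_real_derivative assms(1)] assms(2) by simp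

lemma continuous_on_gauss_moment [continuous_intros]:
  "continuous_on A f \<Longrightarrow> continuous_on A (\<lambda>x. gauss_moment k (f x))"
  by (rule continuous_on_compose2[of UNIV "gauss_moment k"])
     (auto intro!: continuous_at_imp_continuous_on DERIV_isCont gauss_moment_has_real_derivative)

text \<open>
  The total derivative of \<open>y ^ (2 * k + 1) * exp (- (z * y\<^sup>2))\<close> integrated over the unit interval.
\<close>

lemma gauss_moment_recurrence: "(2 * real k + 1) * gauss_moment k z = 2 * z * gauss_moment (Suc k) z + exp (- z)"
proof -
  let ?f = "\<lambda>k y. y ^ (2 * k) * exp (- (z * y\<^sup>2))"
  have "((\<lambda>y. y ^ (2 * k + 1) * exp (- (z * y\<^sup>2))) has_real_derivative
          (2 * real k + 1) * ?f k y - 2 * z * ?f (Suc k) y) (at y within {0..1})" for y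
    by (rule derivative_eq_intros refl)+ (simp add: algebra_simps power2_eq_square)
  then have "((\<lambda>y. (2 * real k + 1) * ?f k y - 2 * z * ?f (Suc k) y) has_integral
         (1 ^ (2 * k + 1) * exp (- (z * 1\<^sup>2)) - 0 ^ (2 * k + 1) * exp (- (z * 0\<^sup>2)))) {0..1}"
    by (intro fundamental_theorem_of_calculus)
       (auto simp flip: has_real_derivative_iff_has_vector_derivative)
  moreover have "(?f k has_integral gauss_moment k z) {0..1}" for k
    unfolding gauss_moment_def by (auto intro!: integrable_integral integrable_continuous_real continuous_intros)
  then have "((\<lambda>y. (2 * real k + 1) * ?f k y - 2 * z * ?f (Suc k) y) has_integral
         ((2 * real k + 1) * gauss_moment k z - 2 * z * gauss_moment (Suc k) z)) {0..1}"
    by (intro has_integral_diff has_integral_mult_right)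
  ultimately have "exp (- z) = (2 * real k + 1) * gauss_moment k z - 2 * z * gauss_moment (Suc k) z"
    by (simp add: has_integral_unique)
  then show ?thesis by simp
qed

text \<open>
  Jensen's inequality: the average of \<open>y\<^sup>2\<close> over the unit interval is \<open>1 / 3\<close>, so the average
  of \<open>exp (- (z * y\<^sup>2))\<close> is at least \<open>exp (- z / 3)\<close>. The bound is used twice: it gives positivity for
  every real \<open>z\<close>, and at large \<open>z\<close> it decays more slowly than \<open>exp (- z)\<close>, which makes
  \<open>exp (- z) / gauss_moment 0 z\<close> decay exponentially.
\<close>

lemma gauss_moment0_lower_bound: "exp (- z / 3) \<le> gauss_moment 0 z"
proof -
  \<comment> \<open>The tangent line to \<open>exp\<close> at \<open>- z / 3\<close>, evaluated at \<open>- z y\<^sup>2\<close>.\<close>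
  let ?a = "\<lambda>y::real. exp (- z / 3) * (1 + z / 3 - z * y\<^sup>2)"
  have "(?a has_integral (exp (- z / 3) * (1 * (1 + z / 3) - z * 1 ^ 3 / 3)
                        - exp (- z / 3) * (0 * (1 + z / 3) - z * 0 ^ 3 / 3))) {0..1}"
    by (intro fundamental_theorem_of_calculus)
       (auto simp flip: has_real_derivative_iff_has_vector_derivative intro!: derivative_eq_intros)
  then have "(?a has_integral exp (- z / 3)) {0..1}" by (simp add: algebra_simps)
  moreover have "((\<lambda>y. exp (- (z * y\<^sup>2))) has_integral gauss_moment 0 z) {0..1}"
    unfolding gauss_moment_def by (auto intro!: integrable_integral integrable_continuous_real continuous_intros)
  moreover have "?a y \<le> exp (- (z * y\<^sup>2))" for y
  proof -
    have "?a y \<le> exp (- z / 3) * exp (z / 3 - z * y\<^sup>2)"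
      using exp_ge_add_one_self[of "z / 3 - z * y\<^sup>2"] by (intro mult_left_mono) (auto simp: algebra_simps)
    then show ?thesis by (simp add: exp_add[symmetric])
  qed
  ultimately show ?thesis by (rule has_integral_le)
qed

lemma gauss_moment0_pos: "0 < gauss_moment 0 z"
  using gauss_moment0_lower_bound[of z] exp_gt_zero[of "- z / 3"] by linarith

lemma erf_eq_gauss_moment: "erf z = 2 / sqrt pi * (z * gauss_moment 0 (z\<^sup>2))"
proof -
  have "(LBINT s=ereal 0..ereal z. exp (- (s\<^sup>2))) = z * gauss_moment 0 (z\<^sup>2) - 0 * gauss_moment 0 (0\<^sup>2)"
  proof (rule interval_integral_FTC_finite)
    fix s
    have "((\<lambda>s. s * gauss_moment 0 (s\<^sup>2)) has_real_derivative exp (- (s\<^sup>2))) (at s)"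
      using gauss_moment_recurrence[of 0 "s\<^sup>2"]
      by (auto intro!: derivative_eq_intros simp: algebra_simps power2_eq_square)
    then show "((\<lambda>s. s * gauss_moment 0 (s\<^sup>2)) has_vector_derivative exp (- (s\<^sup>2))) (at s within {min 0 z..max 0 z})"
      using has_real_derivative_iff_has_vector_derivative has_vector_derivative_at_within by blast
  qed (auto intro!: continuous_intros)
  then show ?thesis by (simp add: erf_def zero_ereal_def)
qed

text \<open>
  \<open>log_slope\<close> is the negated logarithmic derivative of \<open>gauss_moment 0\<close>; \<open>log_slope1\<close> and
  \<open>log_slope2\<close> are its first and second derivatives, written through the moments.
\<close>

definition log_slope :: "real \<Rightarrow> real" where "log_slope z = gauss_moment 1 z / gauss_moment 0 z"
definition log_slope1 :: "real \<Rightarrow> real" where "log_slope1 z = (log_slope z)\<^sup>2 - gauss_moment 2 z / gauss_moment 0 z"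
definition log_slope2 :: "real \<Rightarrow> real" where
  "log_slope2 z = 2 * log_slope z * log_slope1 z + gauss_moment 3 z / gauss_moment 0 z - gauss_moment 2 z * gauss_moment 1 z / (gauss_moment 0 z)\<^sup>2"

lemma gauss_moment0_neq_0 [simp]: "gauss_moment 0 z \<noteq> 0" using gauss_moment0_pos[of z] by simp

lemma log_slope_deriv: "(log_slope has_real_derivative log_slope1 z) (at z)"
  unfolding log_slope_def[abs_def] log_slope1_def
  by (auto intro!: derivative_eq_intros simp: log_slope_def numeral_2_eq_2 field_simps power2_eq_square)

lemma log_slope1_deriv: "(log_slope1 has_real_derivative log_slope2 z) (at z)"
  unfolding log_slope1_def[abs_def] log_slope2_def
  by (auto intro!: derivative_eq_intros log_slope_deriv simp: log_slope1_def log_slope_def numeral_2_eq_2 numeral_3_eq_3 field_simps power2_eq_square)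

text \<open>
  The recurrence at \<open>k = 0, 1, 2\<close> expresses \<open>2 * z\<close> times the next moment through lower ones and
  the common term \<open>exp (- z)\<close>; eliminating that term leaves an identity between the logarithmic
  derivative and its own derivatives. It is the differentiated form of the Riccati equation for
  \<open>log_slope\<close>, and it is exactly the similarity reduction of the equation for the velocity.
\<close>

lemma log_slope_ode: "2 * z * log_slope2 z = 2 * (log_slope z)\<^sup>2 + 4 * z * log_slope z * log_slope1 z - 2 * log_slope z - (5 + 2 * z) * log_slope1 z"
proof -
  define a b c d where "a = gauss_moment 0 z" "b = gauss_moment 1 z" "c = gauss_moment 2 z" "d = gauss_moment 3 z"
  have e: "exp (- z) = a - 2 * z * b" "exp (- z) = 3 * b - 2 * z * c" "exp (- z) = 5 * c - 2 * z * d"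
    using gauss_moment_recurrence[of 0 z] gauss_moment_recurrence[of 1 z] gauss_moment_recurrence[of 2 z]
    unfolding a_b_c_d_def by (simp_all add: numeral_2_eq_2 numeral_3_eq_3)
  have z: "2 * z * c = 3 * b - a + 2 * z * b" "2 * z * d = 5 * c - 3 * b + 2 * z * c" using e by auto
  have a: "a \<noteq> 0" by (simp add: a_b_c_d_def)
  have "2 * z * log_slope2 z = 4 * z * log_slope z * log_slope1 z + (2 * z * d) / a - (2 * z * c) * b / a\<^sup>2"
    by (simp add: log_slope2_def a_b_c_d_def algebra_simps add_divide_distrib)
  also have "\<dots> = 4 * z * log_slope z * log_slope1 z + (5 * c - 3 * b + 2 * z * c) / a - (3 * b - a + 2 * z * b) * b / a\<^sup>2"
    unfolding z ..
  also have "\<dots> = 2 * (log_slope z)\<^sup>2 + 4 * z * log_slope z * log_slope1 z - 2 * log_slope z - (5 + 2 * z) * log_slope1 z"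
    using a unfolding log_slope1_def log_slope_def a_b_c_d_def[symmetric] by (simp add: field_simps power2_eq_square)
  finally show ?thesis .
qed

section \<open>Radial vector fields\<close>

lemma radial_partial:
  fixes x :: "real^'n::finite"
  assumes "(\<phi> has_real_derivative \<phi>') (at (x \<bullet> x))"
  shows "((\<lambda>s. \<phi> ((x + s *\<^sub>R axis j 1) \<bullet> (x + s *\<^sub>R axis j 1))) has_real_derivative 2 * \<phi>' * x $ j) (at 0)"
proof -
  have eq: "(x + s *\<^sub>R axis j 1) \<bullet> (x + s *\<^sub>R axis j 1) = x \<bullet> x + 2 * s * x $ j + s\<^sup>2" for s
    by (simp add: inner_add_left inner_add_right inner_axis inner_axis' power2_eq_square algebra_simps)
  have "((\<lambda>s. x \<bullet> x + 2 * s * x $ j + s\<^sup>2) has_real_derivative 2 * x $ j) (at 0)"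
    by (auto intro!: derivative_eq_intros)
  from DERIV_chain2[of \<phi> \<phi>', OF _ this] assms show ?thesis by (simp add: eq mult_ac)
qed

lemma coordinate_partial:
  fixes x :: "real^'n::finite"
  shows
  "((\<lambda>s. (x + s *\<^sub>R axis j 1) $ i) has_real_derivative of_bool (i = j)) (at 0)"
proof -
  have "(x + s *\<^sub>R axis j 1) $ i = x $ i + s * of_bool (i = j)" for s
    by (auto simp: axis_def)
  then show ?thesis by (simp only:) (auto intro!: derivative_eq_intros)
qed

lemma radial_component_partial:
  fixes x :: "real^'n::finite"
  assumes "(h has_real_derivative h') (at (x \<bullet> x))"
  shows "((\<lambda>s. h ((x + s *\<^sub>R axis j 1) \<bullet> (x + s *\<^sub>R axis j 1)) * (x + s *\<^sub>R axis j 1) $ i)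
          has_real_derivative (2 * h' * x $ j * x $ i + h (x \<bullet> x) * of_bool (i = j))) (at 0)"
  using DERIV_mult'[OF radial_partial[OF assms, of j] coordinate_partial[of x j i]]
  by (simp add: algebra_simps)

text \<open>
  A radial field is written as \<open>h (x \<bullet> x) *\<^sub>R x\<close>, with the squared norm as variable, because then
  all derivatives are polynomial in the coordinates and the origin needs no separate treatment.
  The first partial derivatives are known in a whole neighbourhood of \<open>x\<close>, which is what allows them
  to be differentiated again.
\<close>

lemma radial_laplacian:
  fixes x :: "real^'n::finite" and h h1 h2 :: "real \<Rightarrow> real"
  assumes S: "open S" "x \<bullet> x \<in> S"
    and h: "\<And>y. y \<in> S \<Longrightarrow> (h has_real_derivative h1 y) (at y)"
    and h1: "\<And>y. y \<in> S \<Longrightarrow> (h1 has_real_derivative h2 y) (at y)"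
  shows "laplacian_exists (\<lambda>y. (h (y \<bullet> y) *\<^sub>R y) $ i) x"
    and "laplacian (\<lambda>y. (h (y \<bullet> y) *\<^sub>R y) $ i) x =
          (4 * (x \<bullet> x) * h2 (x \<bullet> x) + (2 * CARD('n) + 4) * h1 (x \<bullet> x)) * x $ i"
proof -
  let ?v = "\<lambda>y::real^'n. (h (y \<bullet> y) *\<^sub>R y) $ i"
  let ?d = "\<lambda>j y::real^'n. 2 * h1 (y \<bullet> y) * y $ j * y $ i + h (y \<bullet> y) * of_bool (i = j)"
  have d: "((\<lambda>s. ?v (y + s *\<^sub>R axis j 1)) has_real_derivative ?d j y) (at 0)" if "y \<bullet> y \<in> S" for y j
    using radial_component_partial[OF h[OF that], of j i] by simp
  have pd: "partially_differentiable j ?v y" "partial_deriv j ?v y = ?d j y" if "y \<bullet> y \<in> S" for y j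
    using d[OF that, of j] unfolding partially_differentiable_def partial_deriv_def field_differentiable_def
    by (blast, rule DERIV_imp_deriv)
  have opn: "open {y::real^'n. y \<bullet> y \<in> S}"
    using open_vimage[OF S(1), of "\<lambda>y::real^'n. y \<bullet> y"] by (simp add: vimage_def continuous_intros)
  have near: "\<forall>\<^sub>F y in nhds x. y \<bullet> y \<in> S"
    using eventually_nhds_in_open[OF opn] S(2) by simp
  let ?dd = "\<lambda>j. 4 * h2 (x \<bullet> x) * (x $ j)\<^sup>2 * x $ i + 2 * h1 (x \<bullet> x) * x $ i
                 + 4 * h1 (x \<bullet> x) * x $ j * of_bool (i = j)"
  have dd: "((\<lambda>s. partial_deriv j ?v (x + s *\<^sub>R axis j 1)) has_real_derivative ?dd j) (at 0)" for j
  proof -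
    have "((\<lambda>s. ?d j (x + s *\<^sub>R axis j 1)) has_real_derivative ?dd j) (at 0)"
    proof -
      have "((\<lambda>s. 2 * (h1 ((x + s *\<^sub>R axis j 1) \<bullet> (x + s *\<^sub>R axis j 1)) * (x + s *\<^sub>R axis j 1) $ j) * (x + s *\<^sub>R axis j 1) $ i
            + h ((x + s *\<^sub>R axis j 1) \<bullet> (x + s *\<^sub>R axis j 1)) * of_bool (i = j)) has_real_derivative ?dd j) (at 0)"
        by (rule derivative_eq_intros radial_component_partial h1 h radial_partial coordinate_partial S refl)+
           (auto simp: algebra_simps power2_eq_square)
      then show ?thesis by (simp add: mult.assoc)
    qed
    moreover have "\<forall>\<^sub>F s in nhds 0. ?d j (x + s *\<^sub>R axis j 1) = partial_deriv j ?v (x + s *\<^sub>R axis j 1)"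
    proof -
      have "((\<lambda>s::real. x + s *\<^sub>R axis j 1) \<longlongrightarrow> x + 0 *\<^sub>R axis j 1) (nhds 0)"
        by (intro tendsto_intros filterlim_ident)
      then have "filterlim (\<lambda>s::real. x + s *\<^sub>R axis j 1) (nhds x) (nhds 0)" by simp
      from eventually_compose_filterlim[OF near this] show ?thesis
        by eventually_elim (simp only: pd)
    qed
    ultimately show ?thesis by (rule iffD1[OF DERIV_cong_ev[OF refl _ refl], rotated])
  qed
  show "laplacian_exists ?v x"
    unfolding laplacian_exists_def
  proof (intro allI conjI)
    show "\<forall>\<^sub>F y in nhds x. partially_differentiable j ?v y" for j
      using near by eventually_elim (rule pd)
    show "partially_differentiable j (partial_deriv j ?v) x" for j
      using dd unfolding partially_differentiable_def field_differentiable_def by blast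
  qed
  have "laplacian ?v x = (\<Sum>j\<in>UNIV. ?dd j)"
    unfolding laplacian_def partial_deriv_def[of _ "partial_deriv _ _"]
    by (intro sum.cong refl DERIV_imp_deriv dd)
  also have "\<dots> = (\<Sum>j\<in>UNIV. 4 * h2 (x \<bullet> x) * (x $ j)\<^sup>2 * x $ i) + (\<Sum>j\<in>(UNIV::'n set). 2 * h1 (x \<bullet> x) * x $ i)
      + (\<Sum>j\<in>UNIV. 4 * h1 (x \<bullet> x) * x $ j * of_bool (i = j))"
    by (simp only: sum.distrib)
  also have "(\<Sum>j\<in>UNIV. 4 * h1 (x \<bullet> x) * x $ j * of_bool (i = j)) = 4 * h1 (x \<bullet> x) * x $ i"
    by (simp add: of_bool_def if_distrib cong: if_cong)
  also have "(\<Sum>j\<in>UNIV. 4 * h2 (x \<bullet> x) * (x $ j)\<^sup>2 * x $ i) + (\<Sum>j\<in>(UNIV::'n set). 2 * h1 (x \<bullet> x) * x $ i)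
      + 4 * h1 (x \<bullet> x) * x $ i = 4 * h2 (x \<bullet> x) * (\<Sum>j\<in>UNIV. (x $ j)\<^sup>2) * x $ i
      + CARD('n) * (2 * h1 (x \<bullet> x) * x $ i) + 4 * h1 (x \<bullet> x) * x $ i"
    by (simp add: sum_distrib_left sum_distrib_right)
  also have "(\<Sum>j\<in>UNIV. (x $ j)\<^sup>2) = x \<bullet> x"
    by (simp add: inner_vec_def power2_eq_square)
  finally show "laplacian ?v x = (4 * (x \<bullet> x) * h2 (x \<bullet> x) + (2 * CARD('n) + 4) * h1 (x \<bullet> x)) * x $ i"
    by (simp add: algebra_simps)
qed

lemma radial_has_derivative:
  fixes x :: "real^'n::finite"
  assumes "(h has_real_derivative h') (at (x \<bullet> x))"
  shows "((\<lambda>y. h (y \<bullet> y) *\<^sub>R y) has_derivative (\<lambda>k. h (x \<bullet> x) *\<^sub>R k + (2 * h' * (x \<bullet> k)) *\<^sub>R x)) (at x)"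
proof -
  have "((\<lambda>y. y \<bullet> y) has_derivative (\<lambda>k. 2 * (x \<bullet> k))) (at x)"
    by (auto intro!: derivative_eq_intros simp: inner_commute)
  from DERIV_compose_FDERIV[OF assms this]
  have "((\<lambda>y. h (y \<bullet> y)) has_derivative (\<lambda>k. 2 * (x \<bullet> k) * h')) (at x)" .
  from has_derivative_scaleR[OF this has_derivative_ident] show ?thesis
    by (simp add: mult_ac)
qed

lemma radial_jacobian:
  fixes x :: "real^'n::finite"
  assumes "(h has_real_derivative h') (at (x \<bullet> x))"
  shows "jacobian (\<lambda>y. h (y \<bullet> y) *\<^sub>R y) (at x) =
           (\<chi> i j. h (x \<bullet> x) * of_bool (i = j) + 2 * h' * x $ j * x $ i)"
    and "jacobian (\<lambda>y. h (y \<bullet> y) *\<^sub>R y) (at x) *v k = h (x \<bullet> x) *\<^sub>R k + (2 * h' * (x \<bullet> k)) *\<^sub>R x"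
proof -
  note d = radial_has_derivative[OF assms]
  have f: "frechet_derivative (\<lambda>y. h (y \<bullet> y) *\<^sub>R y) (at x) = (\<lambda>k. h (x \<bullet> x) *\<^sub>R k + (2 * h' * (x \<bullet> k)) *\<^sub>R x)"
    using frechet_derivative_at[OF d] by simp
  show "jacobian (\<lambda>y. h (y \<bullet> y) *\<^sub>R y) (at x) =
           (\<chi> i j. h (x \<bullet> x) * of_bool (i = j) + 2 * h' * x $ j * x $ i)"
    by (simp add: jacobian_def f matrix_def vec_eq_iff inner_axis) (simp add: axis_def)
  show "jacobian (\<lambda>y. h (y \<bullet> y) *\<^sub>R y) (at x) *v k = h (x \<bullet> x) *\<^sub>R k + (2 * h' * (x \<bullet> k)) *\<^sub>R x"
    unfolding jacobian_def f
    by (rule matrix_works) (use has_derivative_linear[OF d] in \<open>simp add: linear_matrix_vector_mul_eq\<close>)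
qed

text \<open>
  Both the convective term and the Laplacian of a radial field are scalar multiples of \<open>x\<close>, so the
  vector equation reduces to one scalar equation in \<open>t\<close> and \<open>y = x \<bullet> x\<close>. The open set \<open>S\<close> of
  admissible squared norms is \<open>- {0}\<close> for the stationary field and \<open>UNIV\<close> for the other one.
\<close>

lemma radial_classical_solution:
  fixes h ht hy hyy :: "real \<Rightarrow> real \<Rightarrow> real" and u :: "real \<Rightarrow> real^'n \<Rightarrow> real^'n::finite"
  assumes S: "open S"
    and u: "\<And>t x. t > 0 \<Longrightarrow> u t x = h t (x \<bullet> x) *\<^sub>R x"
    and ht: "\<And>t y. t > 0 \<Longrightarrow> y \<in> S \<Longrightarrow> ((\<lambda>s. h s y) has_real_derivative ht t y) (at t)"
    and hy: "\<And>t y. t > 0 \<Longrightarrow> y \<in> S \<Longrightarrow> (h t has_real_derivative hy t y) (at y)"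
    and hyy: "\<And>t y. t > 0 \<Longrightarrow> y \<in> S \<Longrightarrow> (hy t has_real_derivative hyy t y) (at y)"
    and cont: "continuous_on ({0<..} \<times> S) (\<lambda>(t, y). h t y)" "continuous_on ({0<..} \<times> S) (\<lambda>(t, y). ht t y)"
      "continuous_on ({0<..} \<times> S) (\<lambda>(t, y). hy t y)" "continuous_on ({0<..} \<times> S) (\<lambda>(t, y). hyy t y)"
    and pde: "\<And>t y. t > 0 \<Longrightarrow> y \<in> S \<Longrightarrow>
      ht t y + (h t y)\<^sup>2 + 2 * y * h t y * hy t y = \<mu> * (4 * y * hyy t y + (2 * CARD('n) + 4) * hy t y)"
  shows "classical_solution_on \<mu> {x::real^'n. x \<bullet> x \<in> S} u"
proof -
  let ?\<Omega> = "{x::real^'n. x \<bullet> x \<in> S}"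
  have u_eq: "u t = (\<lambda>x. h t (x \<bullet> x) *\<^sub>R x)" if "t > 0" for t using u[OF that] by blast
  have vd: "((\<lambda>s. u s x) has_vector_derivative ht t (x \<bullet> x) *\<^sub>R x) (at t)" if "t > 0" "x \<in> ?\<Omega>" for t x
  proof (rule has_vector_derivative_transform_within_open[where S = "{0<..}"])
    show "((\<lambda>s. h s (x \<bullet> x) *\<^sub>R x) has_vector_derivative ht t (x \<bullet> x) *\<^sub>R x) (at t)"
      using has_vector_derivative_scaleR[OF ht[OF that(1), of "x \<bullet> x"] has_vector_derivative_const] that by simp
  qed (use that u in auto)
  have lap: "vec_laplacian (u t) x =
       (4 * (x \<bullet> x) * hyy t (x \<bullet> x) + (2 * CARD('n) + 4) * hy t (x \<bullet> x)) *\<^sub>R x"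
    if "t > 0" "x \<in> ?\<Omega>" for t x
    using radial_laplacian(2)[OF S, of x "h t" "hy t" "hyy t"] that hy hyy
    by (simp add: vec_laplacian_def vec_eq_iff u_eq)
  note jac = radial_jacobian[where 'n='n, OF hy]
  have c: "continuous_on ({0<..} \<times> ?\<Omega>) (\<lambda>q. F (fst q) (snd q \<bullet> snd q))"
    if "continuous_on ({0<..} \<times> S) (\<lambda>(t, y). F t y)" for F :: "real \<Rightarrow> real \<Rightarrow> real"
    using continuous_on_compose2[OF that, of "{0<..} \<times> ?\<Omega>" "\<lambda>q. (fst q, snd q \<bullet> snd q)"]
    by (force intro!: continuous_intros)
  note [continuous_intros] = cont[THEN c]
  show ?thesis
    unfolding classical_solution_on_def
  proof (intro conjI allI impI ballI)
    fix t :: real and x assume t: "t > 0" and x: "x \<in> ?\<Omega>"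
    show "(\<lambda>s. u s x) differentiable at t"
      using vd[OF t x] by (auto simp: has_vector_derivative_def differentiable_def)
    show "u t differentiable at x"
      using radial_has_derivative[OF hy[OF t]] x by (auto simp: differentiable_def u_eq[OF t])
    show "laplacian_exists (\<lambda>y. u t y $ i) x" for i
      using radial_laplacian(1)[OF S, of x "h t" "hy t" "hyy t"] t x hy hyy by (simp add: u_eq)
    have "vector_derivative (\<lambda>s. u s x) (at t) + jacobian (u t) (at x) *v u t x
        = (ht t (x \<bullet> x) + (h t (x \<bullet> x))\<^sup>2 + 2 * (x \<bullet> x) * h t (x \<bullet> x) * hy t (x \<bullet> x)) *\<^sub>R x"
      using vector_derivative_at[OF vd[OF t x]] jac(2)[OF t, of x "u t x"] x
      by (simp only: mem_Collect_eq u_eq[OF t]) (simp add: algebra_simps power2_eq_square)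
    then show "vector_derivative (\<lambda>s. u s x) (at t) + jacobian (u t) (at x) *v u t x
                    = \<mu> *\<^sub>R vec_laplacian (u t) x"
      using pde[OF t, of "x \<bullet> x"] x lap[OF t x] by simp
  next
    have "continuous_on ({0<..} \<times> ?\<Omega>) (\<lambda>q. ht (fst q) (snd q \<bullet> snd q) *\<^sub>R snd q)"
      by (intro continuous_intros)
    then show "continuous_on ({0<..} \<times> ?\<Omega>) (\<lambda>(t, x). vector_derivative (\<lambda>s. u s x) (at t))"
      by (rule continuous_on_eq) (use vector_derivative_at[OF vd] in auto)
    have "continuous_on ({0<..} \<times> ?\<Omega>) (\<lambda>q. \<chi> i j. h (fst q) (snd q \<bullet> snd q) * of_bool (i = j)
             + 2 * hy (fst q) (snd q \<bullet> snd q) * snd q $ j * snd q $ i)"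
      by (intro continuous_intros)
    then show "continuous_on ({0<..} \<times> ?\<Omega>) (\<lambda>(t, x). jacobian (u t) (at x))"
      by (rule continuous_on_eq) (use jac(1) in \<open>auto simp: u_eq\<close>)
    have "continuous_on ({0<..} \<times> ?\<Omega>) (\<lambda>q. (4 * (snd q \<bullet> snd q) * hyy (fst q) (snd q \<bullet> snd q)
             + (2 * CARD('n) + 4) * hy (fst q) (snd q \<bullet> snd q)) *\<^sub>R snd q)"
      by (intro continuous_intros)
    then show "continuous_on ({0<..} \<times> ?\<Omega>) (\<lambda>(t, x). vec_laplacian (u t) x)"
      by (rule continuous_on_eq) (use lap in auto)
  qed
qed

section \<open>The two velocity fields\<close>

text \<open>
  At the origin both sides are \<open>0\<close>, on the right because of \<open>0 *\<^sub>R x\<close> with \<open>1 / 0 = 0\<close>.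
\<close>

lemma u_st_eq: "u_st \<mu> x = (2 * \<mu> / (x \<bullet> x)) *\<^sub>R x"
  by (simp add: u_st_def power2_norm_eq_inner)

text \<open>
  The pole \<open>1 / r\<close> cancels: with \<open>z = r\<^sup>2 / (4 * \<mu> * t)\<close> the radial velocity is
  \<open>2 * \<mu> / r\<close> times \<open>(gauss_moment 0 z - exp (- z)) / gauss_moment 0 z\<close>, and the recurrence at
  \<open>k = 0\<close> extracts a factor \<open>2 * z\<close> from the numerator. This form is smooth through the origin.
\<close>

lemma u_nst_eq:
  assumes "\<mu> > 0" "t > 0"
  shows "u_nst \<mu> t x = (log_slope (x \<bullet> x / (4 * \<mu> * t)) / t) *\<^sub>R x"
proof (cases "x = 0")
  case False
  define r where "r = norm x"
  define z where "z = x \<bullet> x / (4 * \<mu> * t)"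
  have r: "r > 0" using False by (simp add: r_def)
  have z: "z = r\<^sup>2 / (4 * \<mu> * t)" by (simp add: z_def r_def power2_norm_eq_inner)
  have sq: "(r / sqrt (4 * \<mu> * t))\<^sup>2 = z" using assms by (simp add: z power_divide)
  have "sqrt (\<mu> * pi * t) * erf (r / sqrt (4 * \<mu> * t)) = r * gauss_moment 0 z"
    unfolding erf_eq_gauss_moment sq using assms by (simp add: real_sqrt_mult)
  then have "u_nst_radial \<mu> t r = 2 * \<mu> * (1 / r - exp (- z) / (r * gauss_moment 0 z))"
    unfolding u_nst_radial_def by (simp add: z)
  also have "\<dots> = 2 * \<mu> * (gauss_moment 0 z - exp (- z)) / (r * gauss_moment 0 z)"
    using r by (simp add: field_simps)
  also have "gauss_moment 0 z - exp (- z) = 2 * z * gauss_moment 1 z"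
    using gauss_moment_recurrence[of 0 z] by simp
  also have "2 * \<mu> * (2 * z * gauss_moment 1 z) / (r * gauss_moment 0 z) = r * (log_slope z / t)"
    using r assms by (simp add: log_slope_def z field_simps power2_eq_square)
  finally show ?thesis
    using False by (simp add: u_nst_def r_def z_def)
qed (simp add: u_nst_def)

text \<open>
  The recurrence at \<open>k = 0\<close> once more: \<open>2 * z * log_slope z\<close> differs from \<open>1\<close> by
  \<open>exp (- z) / gauss_moment 0 z\<close>, and the constant \<open>1\<close> is the stationary field.
\<close>

lemma u_nst_minus_u_st:
  assumes "\<mu> > 0" "t > 0"
  defines "z \<equiv> \<lambda>x. x \<bullet> x / (4 * \<mu> * t)"
  shows "u_nst \<mu> t x - u_st \<mu> x = - (2 * \<mu> * exp (- z x) / ((x \<bullet> x) * gauss_moment 0 (z x))) *\<^sub>R x"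
proof (cases "x = 0")
  case False
  have "log_slope (z x) / t - 2 * \<mu> / (x \<bullet> x) = 2 * \<mu> * (2 * z x * gauss_moment 1 (z x) - gauss_moment 0 (z x)) / ((x \<bullet> x) * gauss_moment 0 (z x))"
    using False assms by (simp add: log_slope_def z_def field_simps)
  also have "2 * z x * gauss_moment 1 (z x) - gauss_moment 0 (z x) = - exp (- z x)"
    using gauss_moment_recurrence[of 0 "z x"] by simp
  finally have "log_slope (z x) / t - 2 * \<mu> / (x \<bullet> x) = - (2 * \<mu> * exp (- z x) / ((x \<bullet> x) * gauss_moment 0 (z x)))"
    by simp
  then show ?thesis
    unfolding u_nst_eq[OF assms(1,2)] u_st_eq scaleR_left_diff_distrib[symmetric] by (simp add: z_def)
qed (simp add: u_nst_def u_st_def)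

lemma u_st_classical_solution: "classical_solution_on \<mu> (UNIV - {0}) (\<lambda>t. u_st \<mu>)"
proof -
  have "classical_solution_on \<mu> {x::real^3. x \<bullet> x \<in> - {0}} (\<lambda>t. u_st \<mu>)"
    by (rule radial_classical_solution[where h = "\<lambda>t y. 2 * \<mu> / y" and ht = "\<lambda>t y. 0" and hy = "\<lambda>t y. - 2 * \<mu> / y\<^sup>2" and hyy = "\<lambda>t y. 4 * \<mu> / y ^ 3"])
       (auto intro!: derivative_eq_intros continuous_intros
          simp: case_prod_beta field_simps power2_eq_square power3_eq_cube u_st_eq)
  moreover have "{x::real^3. x \<bullet> x \<in> - {0}} = UNIV - {0}" by auto
  ultimately show ?thesis by simp
qed

lemma log_slope_chain:
  assumes "(f has_real_derivative f') (at x within A)"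
  shows "D = log_slope1 (f x) * f' \<Longrightarrow> ((\<lambda>x. log_slope (f x)) has_real_derivative D) (at x within A)"
    and "D = log_slope2 (f x) * f' \<Longrightarrow> ((\<lambda>x. log_slope1 (f x)) has_real_derivative D) (at x within A)"
  using DERIV_chain2[OF log_slope_deriv assms] DERIV_chain2[OF log_slope1_deriv assms] by simp_all

lemma continuous_on_log_slope [continuous_intros]:
  assumes "continuous_on A f"
  shows "continuous_on A (\<lambda>x. log_slope (f x))" "continuous_on A (\<lambda>x. log_slope1 (f x))" "continuous_on A (\<lambda>x. log_slope2 (f x))"
  unfolding log_slope2_def log_slope1_def log_slope_def using assms by (auto intro!: continuous_intros)

lemma u_nst_classical_solution:
  assumes "\<mu> > 0"
  shows "classical_solution_on \<mu> UNIV (u_nst \<mu>)"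
proof -
  let ?z = "\<lambda>t y. y / (4 * \<mu> * t)"
  have "classical_solution_on \<mu> {x::real^3. x \<bullet> x \<in> UNIV} (u_nst \<mu>)"
  proof (rule radial_classical_solution[
      where h = "\<lambda>t y. log_slope (?z t y) / t"
        and ht = "\<lambda>t y. - (log_slope (?z t y) + ?z t y * log_slope1 (?z t y)) / t\<^sup>2"
        and hy = "\<lambda>t y. log_slope1 (?z t y) / (4 * \<mu> * t\<^sup>2)" and hyy = "\<lambda>t y. log_slope2 (?z t y) / (16 * \<mu>\<^sup>2 * t ^ 3)"])
    fix t y :: real assume t: "t > 0"
    show "((\<lambda>s. log_slope (?z s y) / s) has_real_derivative - (log_slope (?z t y) + ?z t y * log_slope1 (?z t y)) / t\<^sup>2) (at t)"
      using t assms by (auto intro!: derivative_eq_intros log_slope_chain simp: field_simps power2_eq_square)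
    show "((\<lambda>y. log_slope (?z t y) / t) has_real_derivative log_slope1 (?z t y) / (4 * \<mu> * t\<^sup>2)) (at y)"
      using t assms by (auto intro!: derivative_eq_intros log_slope_chain simp: field_simps power2_eq_square)
    show "((\<lambda>y. log_slope1 (?z t y) / (4 * \<mu> * t\<^sup>2)) has_real_derivative log_slope2 (?z t y) / (16 * \<mu>\<^sup>2 * t ^ 3)) (at y)"
      using t assms by (auto intro!: derivative_eq_intros log_slope_chain simp: field_simps power2_eq_square power3_eq_cube)
    define z where "z = ?z t y"
    have y: "y = 4 * \<mu> * t * z" using t assms by (simp add: z_def)
    have "- (log_slope z + z * log_slope1 z) / t\<^sup>2 + (log_slope z / t)\<^sup>2 + 2 * y * (log_slope z / t) * (log_slope1 z / (4 * \<mu> * t\<^sup>2))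
         = (2 * (log_slope z)\<^sup>2 + 4 * z * log_slope z * log_slope1 z - 2 * log_slope z - 2 * z * log_slope1 z) / (2 * t\<^sup>2)"
      using t assms by (simp add: y field_simps power2_eq_square)
    also have "\<dots> = (2 * z * log_slope2 z + 5 * log_slope1 z) / (2 * t\<^sup>2)"
      unfolding log_slope_ode by (simp add: algebra_simps)
    also have "\<dots> = \<mu> * (4 * y * (log_slope2 z / (16 * \<mu>\<^sup>2 * t ^ 3)) + 10 * (log_slope1 z / (4 * \<mu> * t\<^sup>2)))"
      using t assms by (simp add: y field_simps power2_eq_square power3_eq_cube)
    finally show "- (log_slope (?z t y) + ?z t y * log_slope1 (?z t y)) / t\<^sup>2 + (log_slope (?z t y) / t)\<^sup>2
        + 2 * y * (log_slope (?z t y) / t) * (log_slope1 (?z t y) / (4 * \<mu> * t\<^sup>2))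
        = \<mu> * (4 * y * (log_slope2 (?z t y) / (16 * \<mu>\<^sup>2 * t ^ 3)) + (2 * CARD(3) + 4) * (log_slope1 (?z t y) / (4 * \<mu> * t\<^sup>2)))"
      by (simp add: z_def)
  qed (use assms u_nst_eq in \<open>auto simp: case_prod_beta intro!: continuous_intros\<close>)
  then show ?thesis by simp
qed

section \<open>Integrability of a power singularity with Gaussian decay\<close>

lemma nn_integral_lborel_scale:
  fixes f :: "'a::euclidean_space \<Rightarrow> ennreal"
  assumes [measurable]: "f \<in> borel_measurable borel" and c: "c > 0"
  shows "(\<integral>\<^sup>+x. f x \<partial>lborel) = ennreal (c ^ DIM('a)) * (\<integral>\<^sup>+x. f (c *\<^sub>R x) \<partial>lborel)"
  by (subst lborel_affine[of c 0])
     (use c in \<open>simp_all add: nn_integral_density nn_integral_distr nn_integral_cmult\<close>)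

text \<open>
  Completing the square trades the Gaussian for \<open>exp (- \<bar>s\<bar>)\<close>, after which each half line
  contributes the integral defining \<open>Gamma (1 - q)\<close>.
\<close>

lemma nn_integral_power_gaussian_real:
  fixes q c :: real
  assumes "q < 1" "c > 0"
  shows "(\<integral>\<^sup>+s. ennreal (\<bar>s\<bar> powr - q * exp (- (c * s\<^sup>2))) \<partial>lborel) < \<infinity>"
proof -
  let ?g = "\<lambda>s::real. ennreal (indicator {0..} s * s powr (1 - q - 1) / exp s)"
  let ?C = "ennreal (exp (1 / (4 * c)))"
  have "(\<integral>\<^sup>+s. ennreal (\<bar>s\<bar> powr - q * exp (- (c * s\<^sup>2))) \<partial>lborel)
        \<le> (\<integral>\<^sup>+s. ?C * (?g s + ?g (- s)) \<partial>lborel)"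
  proof (rule nn_integral_mono)
    fix s :: real
    have "0 \<le> (2 * c * \<bar>s\<bar> - 1)\<^sup>2 / (4 * c)" using assms by simp
    also have "\<dots> = c * s\<^sup>2 - \<bar>s\<bar> + 1 / (4 * c)"
      using assms by (simp add: field_simps power2_eq_square)
    finally have gauss: "exp (- (c * s\<^sup>2)) \<le> exp (1 / (4 * c)) * exp (- \<bar>s\<bar>)"
      by (simp add: exp_add[symmetric])
    have "\<bar>s\<bar> powr - q * exp (- (c * s\<^sup>2)) \<le> exp (1 / (4 * c)) * (\<bar>s\<bar> powr - q * exp (- \<bar>s\<bar>))"
      using mult_left_mono[OF gauss, of "\<bar>s\<bar> powr - q"] by (simp add: mult_ac)
    then have "ennreal (\<bar>s\<bar> powr - q * exp (- (c * s\<^sup>2))) \<le> ?C * ennreal (\<bar>s\<bar> powr - q * exp (- \<bar>s\<bar>))"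
      by (simp add: ennreal_mult[symmetric] ennreal_leI)
    also have "ennreal (\<bar>s\<bar> powr - q * exp (- \<bar>s\<bar>)) \<le> ?g s + ?g (- s)"
      by (cases "s \<ge> 0") (auto simp: indicator_def exp_minus field_simps)
    finally show "ennreal (\<bar>s\<bar> powr - q * exp (- (c * s\<^sup>2))) \<le> ?C * (?g s + ?g (- s))"
      by (simp add: mult_left_mono)
  qed
  also have "\<dots> = ?C * ((\<integral>\<^sup>+s. ?g s \<partial>lborel) + (\<integral>\<^sup>+s. ?g (- s) \<partial>lborel))"
    by (subst nn_integral_cmult, measurable, subst nn_integral_add) simp_all
  also have "(\<integral>\<^sup>+s. ?g (- s) \<partial>lborel) = (\<integral>\<^sup>+s. ?g s \<partial>lborel)"
    using nn_integral_real_affine[of ?g "- 1" 0] by simp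
  also have "(\<integral>\<^sup>+s. ?g s \<partial>lborel) = ennreal (Gamma (1 - q))"
    using Gamma_conv_nn_integral_real[of "1 - q"] assms by simp
  finally show ?thesis
    by (rule le_less_trans) (simp add: ennreal_mult_less_top)
qed

lemma AE_lborel_coordinates_nonzero:
  "AE x in (lborel :: 'a::euclidean_space measure). \<forall>b\<in>Basis. x \<bullet> b \<noteq> 0"
proof (rule AE_finite_allI)
  fix b :: 'a assume "b \<in> Basis"
  then have "{x. x \<bullet> b = 0} \<in> null_sets lebesgue"
    using negligible_standard_hyperplane[of b 0] by (simp add: negligible_iff_null_sets)
  from AE_not_in[OF this] show "AE x in lborel. x \<bullet> b \<noteq> 0"
    by (simp add: AE_completion_iff)
qed simp

text \<open>
  Since \<open>norm x\<close> dominates every coordinate, \<open>norm x powr - a\<close> is at most the product over all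
  coordinates of \<open>\<bar>x \<bullet> b\<bar> powr - (a / DIM('a))\<close>, and the Gaussian is a product as well. Tonelli's theorem
  then reduces the claim to one dimension, where the exponent is below \<open>1\<close> exactly when
  \<open>a < DIM('a)\<close>. The inequality fails on the coordinate
  hyperplanes, where \<open>0 powr - q = 0\<close>, but these form a null set.
\<close>

lemma nn_integral_power_gaussian:
  fixes a c :: real
  assumes "0 \<le> a" "a < DIM('a::euclidean_space)" "c > 0"
  shows "(\<integral>\<^sup>+(x::'a). ennreal (norm x powr - a * exp (- (c * (x \<bullet> x)))) \<partial>lborel) < \<infinity>"
proof -
  define q where "q = a / DIM('a)"
  let ?f = "\<lambda>s::real. ennreal (\<bar>s\<bar> powr - q * exp (- (c * s\<^sup>2)))"
  interpret product_sigma_finite "\<lambda>b::'a. lborel :: real measure" by standard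
  have q: "0 \<le> q" "q < 1" "a = q * DIM('a)" using assms by (simp_all add: q_def)
  have "(\<integral>\<^sup>+(x::'a). ennreal (norm x powr - a * exp (- (c * (x \<bullet> x)))) \<partial>lborel)
        \<le> (\<integral>\<^sup>+(x::'a). (\<Prod>b\<in>Basis. ?f (x \<bullet> b)) \<partial>lborel)"
  proof (rule nn_integral_mono_AE, rule AE_mp[OF AE_lborel_coordinates_nonzero], intro AE_I2 impI)
    fix x :: 'a assume x: "\<forall>b\<in>Basis. x \<bullet> b \<noteq> 0"
    then have "x \<noteq> 0" using nonempty_Basis by auto
    have "norm x powr - a = (\<Prod>b\<in>(Basis::'a set). norm x powr - q)"
      using \<open>x \<noteq> 0\<close> by (simp add: q(3) powr_powr flip: powr_realpow)
    also have "\<dots> \<le> (\<Prod>b\<in>Basis. \<bar>x \<bullet> b\<bar> powr - q)"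
      using x q by (intro prod_mono conjI powr_mono2') (auto simp: Basis_le_norm)
    finally have 1: "norm x powr - a \<le> (\<Prod>b\<in>Basis. \<bar>x \<bullet> b\<bar> powr - q)" .
    have "x \<bullet> x = (\<Sum>b\<in>Basis. (x \<bullet> b)\<^sup>2)"
      by (subst euclidean_inner) (simp add: power2_eq_square)
    then have 2: "exp (- (c * (x \<bullet> x))) = (\<Prod>b\<in>Basis. exp (- (c * (x \<bullet> b)\<^sup>2)))"
      by (simp add: exp_sum[symmetric] sum_distrib_left sum_negf)
    have "norm x powr - a * exp (- (c * (x \<bullet> x)))
          \<le> (\<Prod>b\<in>Basis. \<bar>x \<bullet> b\<bar> powr - q) * (\<Prod>b\<in>Basis. exp (- (c * (x \<bullet> b)\<^sup>2)))"
      unfolding 2 using 1 by (rule mult_right_mono) (simp add: prod_nonneg)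
    then show "ennreal (norm x powr - a * exp (- (c * (x \<bullet> x)))) \<le> (\<Prod>b\<in>Basis. ?f (x \<bullet> b))"
      by (simp add: prod_ennreal prod.distrib ennreal_leI)
  qed
  also have "\<dots> = (\<integral>\<^sup>+y. (\<Prod>b\<in>(Basis::'a set). ?f (y b)) \<partial>(\<Pi>\<^sub>M b\<in>Basis. lborel))"
    by (subst lborel_eq, subst nn_integral_distr)
       (auto intro!: nn_integral_cong prod.cong simp: inner_sum_left_Basis)
  also have "\<dots> = (\<Prod>b\<in>(Basis::'a set). \<integral>\<^sup>+s. ?f s \<partial>lborel)"
    by (rule product_nn_integral_prod) auto
  also have "\<dots> < \<infinity>"
    using nn_integral_power_gaussian_real[OF q(2) assms(3)] by (simp add: power_less_top_ennreal)
  finally show ?thesis .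
qed

section \<open>Convergence to the initial data\<close>

text \<open>
  The modulus of the difference of the two fields in similarity variables, normalised to length
  scale \<open>1\<close>.
\<close>

definition defect :: "real^3 \<Rightarrow> real" where
  "defect y = exp (- (y \<bullet> y)) / (norm y * gauss_moment 0 (y \<bullet> y))"

lemma defect_nonneg: "0 \<le> defect y"
  using gauss_moment0_pos[of "y \<bullet> y"] by (simp add: defect_def)

lemma defect_eq_0_iff: "defect y = 0 \<longleftrightarrow> y = 0"
  by (simp add: defect_def)

lemma defect_measurable [measurable]: "defect \<in> borel_measurable borel"
proof -
  have [measurable]: "gauss_moment 0 \<in> borel_measurable borel"
    by (intro borel_measurable_continuous_onI continuous_on_gauss_moment continuous_on_id)
  show ?thesis unfolding defect_def[abs_def] by measurable
qed

text \<open>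
  Parabolic self-similarity: time enters only through the length scale \<open>sqrt (4 * \<mu> * t)\<close>.
\<close>

lemma norm_u_nst_minus_u_st:
  assumes "\<mu> > 0" "t > 0"
  shows "norm (u_nst \<mu> t x - u_st \<mu> x) = 2 * \<mu> / sqrt (4 * \<mu> * t) * defect (x /\<^sub>R sqrt (4 * \<mu> * t))"
proof (cases "x = 0")
  case True then show ?thesis by (simp add: u_nst_def u_st_def defect_def)
next
  case False
  define \<sigma> where "\<sigma> = sqrt (4 * \<mu> * t)"
  have \<sigma>: "\<sigma> > 0" "\<sigma>\<^sup>2 = 4 * \<mu> * t" using assms by (simp_all add: \<sigma>_def)
  define z where "z = x \<bullet> x / (4 * \<mu> * t)"
  have z: "(x /\<^sub>R \<sigma>) \<bullet> (x /\<^sub>R \<sigma>) = z"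
    using \<sigma> by (simp add: z_def \<sigma>(2)[symmetric] field_simps power2_eq_square)
  have "norm (u_nst \<mu> t x - u_st \<mu> x) = 2 * \<mu> * exp (- z) / ((x \<bullet> x) * gauss_moment 0 z) * norm x"
    using u_nst_minus_u_st[OF assms, of x] gauss_moment0_pos[of z] assms by (simp add: z_def)
  also have "\<dots> = 2 * \<mu> * exp (- z) / (norm x * gauss_moment 0 z)"
    using False by (simp add: field_simps dot_square_norm power2_eq_square)
  also have "\<dots> = 2 * \<mu> / \<sigma> * defect (x /\<^sub>R \<sigma>)"
    unfolding defect_def z using \<sigma> by (simp add: divide_inverse mult_ac)
  finally show ?thesis by (simp add: \<sigma>_def)
qed

text \<open>
  The defect behaves like \<open>1 / norm y\<close> at the origin, which is where \<open>p < 3\<close> is needed, and decays like a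
  Gaussian at infinity although neither field does.
\<close>

lemma nn_integral_defect_finite:
  assumes "0 < p" "p < 3"
  shows "(\<integral>\<^sup>+y. ennreal (defect y powr p) \<partial>lborel) < \<infinity>"
proof -
  have "(\<integral>\<^sup>+y. ennreal (defect y powr p) \<partial>lborel)
      \<le> (\<integral>\<^sup>+(y::real^3). ennreal (norm y powr - p * exp (- (2 * p / 3 * (y \<bullet> y)))) \<partial>lborel)"
  proof (intro nn_integral_mono ennreal_leI)
    fix y :: "real^3"
    show "defect y powr p \<le> norm y powr - p * exp (- (2 * p / 3 * (y \<bullet> y)))"
    proof (cases "y = 0")
      case False
      have "defect y \<le> exp (- (y \<bullet> y)) / (norm y * exp (- (y \<bullet> y) / 3))"
        unfolding defect_def using False gauss_moment0_lower_bound[of "y \<bullet> y"] gauss_moment0_pos[of "y \<bullet> y"]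
        by (intro divide_left_mono mult_left_mono) auto
      also have "exp (- (y \<bullet> y)) = exp (- (2 / 3 * (y \<bullet> y))) * exp (- (y \<bullet> y) / 3)"
        by (simp flip: exp_add)
      also have "\<dots> / (norm y * exp (- (y \<bullet> y) / 3)) = exp (- (2 / 3 * (y \<bullet> y))) / norm y"
        by simp
      finally have "defect y powr p \<le> (exp (- (2 / 3 * (y \<bullet> y))) / norm y) powr p"
        using defect_nonneg assms by (intro powr_mono2) auto
      also have "\<dots> = norm y powr - p * exp (- (2 * p / 3 * (y \<bullet> y)))"
        by (simp add: powr_divide exp_powr_real powr_minus field_simps)
      finally show ?thesis .
    qed (simp add: defect_def)
  qed
  also have "\<dots> < \<infinity>"
    by (rule nn_integral_power_gaussian) (use assms in auto)
  finally show ?thesis .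
qed

lemma nn_integral_defect_nonzero: "(\<integral>\<^sup>+y. ennreal (defect y powr p) \<partial>lborel) \<noteq> 0"
proof
  assume "(\<integral>\<^sup>+y. ennreal (defect y powr p) \<partial>lborel) = 0"
  then have "AE y in lborel. ennreal (defect y powr p) = 0"
    by (subst (asm) nn_integral_0_iff_AE) auto
  with AE_lborel_singleton[of "0::real^3"] have "AE y in (lborel :: (real^3) measure). False"
    by eventually_elim (simp add: defect_eq_0_iff)
  then show False
    by (simp add: ae_filter_eq_bot_iff)
qed

text \<open>
  Rescaling the integral by \<open>\<sigma> = sqrt (4 * \<mu> * t)\<close> yields \<open>\<sigma> ^ 3\<close> from the volume element and
  \<open>\<sigma> powr - p\<close> from the amplitude. The norm is therefore an exact power of \<open>\<sigma>\<close> with a positive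
  exponent, and its constant is neither \<open>0\<close> nor infinite.
\<close>

lemma Lp_norm_u_nst_minus_u_st:
  assumes "\<mu> > 0" and p: "1 \<le> p" "p < 3"
  obtains C where "C > 0" and
    "\<And>t. t > 0 \<Longrightarrow> Lp_norm p (\<lambda>x. u_nst \<mu> t x - u_st \<mu> x) = ennreal (C * sqrt (4 * \<mu> * t) powr ((3 - p) / p))"
proof -
  define J where "J = (\<integral>\<^sup>+y. ennreal (defect y powr p) \<partial>lborel)"
  define j where "j = enn2real J"
  have J: "J = ennreal j" "j > 0"
    using nn_integral_defect_finite[of p] nn_integral_defect_nonzero[of p] p
    by (auto simp: J_def j_def enn2real_positive_iff zero_less_iff_neq_zero)
  show ?thesis
  proof (rule that[of "2 * \<mu> * j powr (1 / p)"])
    show "2 * \<mu> * j powr (1 / p) > 0" using assms J by simp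
    fix t :: real assume t: "t > 0"
    define \<sigma> where "\<sigma> = sqrt (4 * \<mu> * t)"
    have \<sigma>: "\<sigma> > 0" using assms t by (simp add: \<sigma>_def)
    let ?w = "\<lambda>x. u_nst \<mu> t x - u_st \<mu> x"
    have norm_w: "norm (?w x) = 2 * \<mu> / \<sigma> * defect (x /\<^sub>R \<sigma>)" for x
      using norm_u_nst_minus_u_st[OF assms(1) t] by (simp add: \<sigma>_def)
    have "(\<integral>\<^sup>+x. ennreal (norm (?w x) powr p) \<partial>lebesgue)
        = (\<integral>\<^sup>+x. ennreal ((2 * \<mu> / \<sigma> * defect (x /\<^sub>R \<sigma>)) powr p) \<partial>lborel)"
      by (simp add: norm_w nn_integral_completion)
    also have "\<dots> = ennreal (\<sigma> ^ 3) * (\<integral>\<^sup>+y. ennreal ((2 * \<mu> / \<sigma> * defect y) powr p) \<partial>lborel)"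
      using \<sigma> by (subst nn_integral_lborel_scale[OF _ \<sigma>]) simp_all
    also have "(\<integral>\<^sup>+y. ennreal ((2 * \<mu> / \<sigma> * defect y) powr p) \<partial>lborel)
        = (\<integral>\<^sup>+y. ennreal ((2 * \<mu> / \<sigma>) powr p) * ennreal (defect y powr p) \<partial>lborel)"
      using \<sigma> assms defect_nonneg by (intro nn_integral_cong) (subst powr_mult, simp_all add: ennreal_mult)
    also have "\<dots> = ennreal ((2 * \<mu> / \<sigma>) powr p) * J"
      unfolding J_def by (rule nn_integral_cmult) measurable
    also have "ennreal (\<sigma> ^ 3) * \<dots> = ennreal (\<sigma> ^ 3 * (2 * \<mu> / \<sigma>) powr p * j)"
      using \<sigma> J by (simp add: ennreal_mult[symmetric] mult.assoc)
    also have "\<sigma> ^ 3 * (2 * \<mu> / \<sigma>) powr p * j = (2 * \<mu>) powr p * \<sigma> powr (3 - p) * j"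
      using \<sigma> assms by (simp add: powr_divide powr_diff)
    finally have I: "(\<integral>\<^sup>+x. ennreal (norm (?w x) powr p) \<partial>lebesgue)
        = ennreal ((2 * \<mu>) powr p * \<sigma> powr (3 - p) * j)" .
    have "((2 * \<mu>) powr p * \<sigma> powr (3 - p) * j) powr (1 / p)
        = 2 * \<mu> * \<sigma> powr ((3 - p) / p) * j powr (1 / p)"
      using \<sigma> assms J by (simp add: powr_mult powr_powr)
    then show "Lp_norm p ?w = ennreal (2 * \<mu> * j powr (1 / p) * sqrt (4 * \<mu> * t) powr ((3 - p) / p))"
      using \<sigma> assms J unfolding Lp_norm_def I by (simp add: \<sigma>_def mult_ac)
  qed
qed

theorem mainTheorem4:
  fixes \<mu> :: real
  assumes "\<mu> > 0"
  shows "classical_solution_on \<mu> (UNIV - {0}) (\<lambda>t. u_st \<mu>)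
    \<and> (\<exists>s>0. \<exists>t>0. u_nst \<mu> s \<noteq> u_nst \<mu> t)
    \<and> filterlim (\<lambda>x. norm (u_st \<mu> x)) at_top (at 0)
    \<and> (\<forall>p. 1 \<le> p \<and> p < 3 \<longrightarrow>
         Lp_acceptable_solution \<mu> p (u_st \<mu>) (u_nst \<mu>)
       \<and> tends_in_Lp p (\<lambda>t. u_st \<mu>) (u_st \<mu>)
       \<and> (\<exists>t>0. Lp_norm p (\<lambda>x. u_nst \<mu> t x - u_st \<mu> x) \<noteq> 0))"
proof -
  have lim: "tends_in_Lp p (u_nst \<mu>) (u_st \<mu>)"
    and nz: "\<And>t. t > 0 \<Longrightarrow> Lp_norm p (\<lambda>x. u_nst \<mu> t x - u_st \<mu> x) \<noteq> 0"
    if p: "1 \<le> p" "p < 3" for p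
  proof -
    obtain C where C: "C > 0" "\<And>t. t > 0 \<Longrightarrow>
        Lp_norm p (\<lambda>x. u_nst \<mu> t x - u_st \<mu> x) = ennreal (C * sqrt (4 * \<mu> * t) powr ((3 - p) / p))"
      using Lp_norm_u_nst_minus_u_st[OF assms p] by metis
    show "Lp_norm p (\<lambda>x. u_nst \<mu> t x - u_st \<mu> x) \<noteq> 0" if "t > 0" for t
      using C assms that by (simp add: ennreal_eq_0_iff not_le)
    have "((\<lambda>t. sqrt (4 * \<mu> * t)) \<longlongrightarrow> sqrt (4 * \<mu> * 0)) (at_right 0)"
      by (intro tendsto_intros)
    then have "((\<lambda>t. sqrt (4 * \<mu> * t) powr ((3 - p) / p)) \<longlongrightarrow> 0) (at_right 0)"
      using p assms by (intro tendsto_zero_powrI[where b = "(3 - p) / p"]) (auto simp: eventually_at_filter)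
    then have "((\<lambda>t. ennreal (C * sqrt (4 * \<mu> * t) powr ((3 - p) / p))) \<longlongrightarrow> ennreal (C * 0)) (at_right 0)"
      by (intro tendsto_ennrealI tendsto_mult_left)
    moreover have "\<forall>\<^sub>F t in at_right 0. ennreal (C * sqrt (4 * \<mu> * t) powr ((3 - p) / p))
        = Lp_norm p (\<lambda>x. u_nst \<mu> t x - u_st \<mu> x)"
      using eventually_at_right_less[of 0] by eventually_elim (simp add: C(2))
    ultimately show "tends_in_Lp p (u_nst \<mu>) (u_st \<mu>)"
      unfolding tends_in_Lp_def by (auto elim: Lim_transform_eventually)
  qed
  \<comment> \<open>A field that did not depend on time would have to coincide with its initial data in \<open>L\<^sup>1\<close>.\<close>
  have "\<exists>s>0. \<exists>t>0. u_nst \<mu> s \<noteq> u_nst \<mu> t"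
  proof (rule ccontr)
    assume "\<not> ?thesis"
    then have const: "u_nst \<mu> t = u_nst \<mu> 1" if "t > 0" for t
      using that by (meson zero_less_one)
    let ?c = "Lp_norm 1 (\<lambda>x. u_nst \<mu> 1 x - u_st \<mu> x)"
    have "((\<lambda>t. ?c) \<longlongrightarrow> 0) (at_right (0::real))"
    proof (rule Lim_transform_eventually)
      show "((\<lambda>t. Lp_norm 1 (\<lambda>x. u_nst \<mu> t x - u_st \<mu> x)) \<longlongrightarrow> 0) (at_right 0)"
        using lim[of 1] by (simp add: tends_in_Lp_def)
      show "\<forall>\<^sub>F t in at_right 0. Lp_norm 1 (\<lambda>x. u_nst \<mu> t x - u_st \<mu> x) = ?c"
        using eventually_at_right_less[of 0] by eventually_elim (subst const, simp_all)
    qed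
    then have "?c = 0" by (simp add: tendsto_const_iff)
    then show False using nz[of 1 1] by simp
  qed
  moreover have "filterlim (\<lambda>x. norm (u_st \<mu> x)) at_top (at 0)"
  proof -
    have "filterlim (\<lambda>x::real^3. 2 * \<mu> / norm x) at_top (at 0)"
      by (rule LIM_at_top_divide[OF tendsto_const])
         (use assms in \<open>auto intro!: tendsto_norm_zero tendsto_ident_at simp: eventually_at_filter\<close>)
    then show ?thesis
      by (rule filterlim_mono_eventually) (use assms in \<open>auto simp: u_st_def eventually_at_filter power2_eq_square\<close>)
  qed
  moreover have "u_st \<mu> \<in> borel_measurable lebesgue"
    unfolding u_st_eq[abs_def] by (rule measurable_completion) measurable
  moreover have "tends_in_Lp p (\<lambda>t. u_st \<mu>) (u_st \<mu>)" for p
    by (simp add: tends_in_Lp_def Lp_norm_def)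
  ultimately show ?thesis
    using u_st_classical_solution u_nst_classical_solution[OF assms] lim nz
    by (auto simp: Lp_acceptable_solution_def intro: exI[of _ 1])
qed

end
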